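(* Let $f$ be a continuous complex-valued function on the unit disc $\{z\in\mathbb{C}:|z|<1\}$ that is continuously differentiable (in the real sense) on the set $\{z: f(z)\neq 0\}$ and that satisfies on that set $$\frac{\partial f}{\partial\overline z}=|f|^{1/2}.$$ If $f(0)\neq 0$, then $\sup_{|z|<1}|f(z)|\ge \frac{1}{10}$.
   Context: With $z=x+iy$, $\frac{\partial}{\partial\overline z}=\frac12\left(\frac{\partial}{\partial x}+i\frac{\partial}{\partial y}\right)$. *)

theory Defs
  imports "HOL-Analysis.Analysis"
begin

(* Meant for open S: the derivative is the full Frechet derivative over the reals,
   and its continuity is with respect to the operator norm. *)
definition continuously_differentiable_on ::
  "('a::real_normed_vector \<Rightarrow> 'b::real_normed_vector) \<Rightarrow> 'a set \<Rightarrow> bool"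
  where "continuously_differentiable_on f S \<longleftrightarrow>
    (\<exists>f' :: 'a \<Rightarrow> 'a \<Rightarrow>\<^sub>L 'b.
      (\<forall>x\<in>S. (f has_derivative blinfun_apply (f' x)) (at x)) \<and> continuous_on S f')"

definition partial_x :: "(complex \<Rightarrow> complex) \<Rightarrow> complex \<Rightarrow> complex"
  where "partial_x f z = vector_derivative (\<lambda>x. f (Complex x (Im z))) (at (Re z))"

definition partial_y :: "(complex \<Rightarrow> complex) \<Rightarrow> complex \<Rightarrow> complex"
  where "partial_y f z = vector_derivative (\<lambda>y. f (Complex (Re z) y)) (at (Im z))"

definition dbar :: "(complex \<Rightarrow> complex) \<Rightarrow> complex \<Rightarrow> complex"
  where "dbar f z = 1/2 * (partial_x f z + \<i> * partial_y f z)"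

end

(* Suppose |f| < M < 1/10 and let w maximise v = |f|^2 - |z|^4 / 100 over a closed disc on whose boundary
   v < 0; since v(0) > 0, w is interior and f(w) is nonzero. Formally, the equation gives
   Laplace(|f|^2) >= (23/4) |f| where f is nonzero, which at w exceeds Laplace(|z|^4) / 100 and
   contradicts maximality.
   As f is only C^1, the Laplacian is read off from the growth of the integral m(r) of |f|^2 over circles
   of radius r around w. In polar coordinates f_r = 2 conj(e) |f|^(1/2) - (i/r) f_theta with e = exp(i theta),
   and f_theta has mean zero, so m'(r) only involves increments f - f(w), and m'(r)/r converges by
   differentiability at the single point w. *)
theory Submission
  imports Defs
begin

section \<open>Integrals of trigonometric polynomials over a full period\<close>

text \<open>Nonconstant exponentials integrate to zero over a period. Frequencies up to two suffice:
  the integrands below are products of two expressions, each of degree at most one in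
  \<open>cis t\<close> and its conjugate.\<close>

lemma has_integral_trig_poly:
  fixes a b c d e :: complex
  shows "((\<lambda>t. a + b * cis t + c * cnj (cis t) + d * (cis t)\<^sup>2 + e * (cnj (cis t))\<^sup>2)
           has_integral of_real (2 * pi) * a) {0..2 * pi}"
proof -
  define F where "F = (\<lambda>t. of_real t * a - \<i> * b * cis t + \<i> * c * cnj (cis t)
      - \<i> * d * (cis t)\<^sup>2 / 2 + \<i> * e * (cnj (cis t))\<^sup>2 / 2)"
  have der_cis: "(cis has_vector_derivative \<i> * cis t) (at t within {0..2*pi})" for t
    unfolding has_vector_derivative_def
    by (rule has_derivative_eq_rhs[OF has_derivative_cis[OF has_derivative_ident]]) (simp add: fun_eq_iff)
  have der_cnj: "((\<lambda>t. cnj (cis t)) has_vector_derivative - \<i> * cnj (cis t)) (at t within {0..2*pi})" for t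
    using has_vector_derivative_cnj[OF der_cis[of t]] by simp
  have "((\<lambda>t. a + b * cis t + c * cnj (cis t) + d * (cis t)\<^sup>2 + e * (cnj (cis t))\<^sup>2)
           has_integral F (2 * pi) - F 0) {0..2 * pi}"
  proof (rule fundamental_theorem_of_calculus)
    fix t :: real
    have "(F has_vector_derivative
        1 * a - \<i> * b * (\<i> * cis t) + \<i> * c * (- \<i> * cnj (cis t))
      - \<i> * d / 2 * (cis t * (\<i> * cis t) + (\<i> * cis t) * cis t)
      + \<i> * e / 2 * (cnj (cis t) * (- \<i> * cnj (cis t)) + (- \<i> * cnj (cis t)) * cnj (cis t)))
      (at t within {0..2*pi})"
      unfolding F_def power2_eq_square
      by (rule has_vector_derivative_eq_rhs,
          (rule derivative_intros der_cis der_cnj has_vector_derivative_mult_right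
            has_vector_derivative_mult_left has_vector_derivative_mult
            has_vector_derivative_divide has_vector_derivative_of_real)+)
        (simp add: algebra_simps)
    then show "(F has_vector_derivative a + b * cis t + c * cnj (cis t) + d * (cis t)\<^sup>2 + e * (cnj (cis t))\<^sup>2)
        (at t within {0..2*pi})"
      by (rule has_vector_derivative_eq_rhs) (simp add: power2_eq_square algebra_simps)
  qed simp
  moreover have "F (2 * pi) - F 0 = of_real (2 * pi) * a"
    by (simp add: F_def)
  ultimately show ?thesis by simp
qed

text \<open>Gives the exact circle mean of the comparison function |z|^4. The square of |w + r e|^2
  has frequencies at most two, and its constant term is (|w|^2 + r^2)^2 + 2 r^2 |w|^2.\<close>

lemma circle_mean_norm_power4:
  "((\<lambda>t. cmod (w + of_real r * cis t) ^ 4) has_integral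
     2 * pi * (cmod w ^ 4 + 4 * (cmod w)\<^sup>2 * r\<^sup>2 + r ^ 4)) {0..2 * pi}"
proof -
  \<comment> \<open>\<open>A\<close> is the constant Fourier coefficient of |w + r e|^2; the other
    two are \<open>R * cnj w\<close> and \<open>R * w\<close>.\<close>
  define A where "A = complex_of_real ((cmod w)\<^sup>2 + r\<^sup>2)"
  define R where "R = complex_of_real r"
  have cisn: "cis t * cnj (cis t) = 1" for t
    by (simp add: cis_cnj cis_mult)
  have eq: "complex_of_real (cmod (w + of_real r * cis t) ^ 4) =
     (A\<^sup>2 + 2 * R\<^sup>2 * (w * cnj w)) + (2 * A * R * cnj w) * cis t + (2 * A * R * w) * cnj (cis t)
     + (R * cnj w)\<^sup>2 * (cis t)\<^sup>2 + (R * w)\<^sup>2 * (cnj (cis t))\<^sup>2" for t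
  proof -
    have A: "A = w * cnj w + R\<^sup>2" unfolding A_def R_def using complex_norm_square[of w] by simp
    have "complex_of_real (cmod (w + of_real r * cis t) ^ 4) =
       (complex_of_real ((cmod (w + of_real r * cis t))\<^sup>2))\<^sup>2"
      by (metis of_real_power power_even_eq numeral_Bit0 mult_2)
    also have "\<dots> = ((w + R * cis t) * (cnj w + R * cnj (cis t)))\<^sup>2"
      unfolding R_def complex_norm_square by simp
    also have "(w + R * cis t) * (cnj w + R * cnj (cis t)) = w * cnj w + R * cnj w * cis t + R * w * cnj (cis t) + R\<^sup>2 * (cis t * cnj (cis t))"
      by (simp add: algebra_simps power2_eq_square)
    also have "\<dots>\<^sup>2 = (A\<^sup>2 + 2 * R\<^sup>2 * (w * cnj w) * (cis t * cnj (cis t))) + (2 * A * R * cnj w) * cis t + (2 * A * R * w) * cnj (cis t)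
     + (R * cnj w)\<^sup>2 * (cis t)\<^sup>2 + (R * w)\<^sup>2 * (cnj (cis t))\<^sup>2"
      unfolding cisn A by (simp add: power2_eq_square) (use cisn[of t] in algebra)
    finally show ?thesis unfolding cisn by simp
  qed
  have "((\<lambda>t. Re (complex_of_real (cmod (w + of_real r * cis t) ^ 4))) has_integral
      Re (of_real (2 * pi) * (A\<^sup>2 + 2 * R\<^sup>2 * (w * cnj w)))) {0..2*pi}"
    unfolding eq by (rule has_integral_Re[OF has_integral_trig_poly])
  moreover have "A\<^sup>2 + 2 * R\<^sup>2 * (w * cnj w) = of_real (cmod w ^ 4 + 4 * (cmod w)\<^sup>2 * r\<^sup>2 + r ^ 4)"
    unfolding A_def R_def complex_norm_square[symmetric]
    by (simp add: power2_eq_square power4_eq_xxxx algebra_simps)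
  ultimately show ?thesis by (simp del: of_real_add of_real_mult of_real_power add: Re_complex_of_real flip: of_real_mult)
qed

section \<open>Limits along shrinking circles\<close>

text \<open>All points of the circle lie at the same distance r from w, so the Frechet remainder at
  w is o(r) uniformly in the angle. This later allows passing to the limit under the
  integral.\<close>

lemma uniform_limit_circle_quotient:
  fixes \<phi> :: "complex \<Rightarrow> complex"
  assumes "(\<phi> has_derivative \<phi>') (at w)"
  shows "uniform_limit A (\<lambda>r t. (\<phi> (w + of_real r * cis t) - \<phi> w) / of_real r)
           (\<lambda>t. \<phi>' (cis t)) (at_right 0)"
proof (rule uniform_limitI)
  fix e :: real assume "e > 0"
  interpret bounded_linear \<phi>' using assms by (rule has_derivative_bounded_linear)
  obtain d where d: "d > 0" "\<And>y. norm (y - w) < d \<Longrightarrow> norm (\<phi> y - \<phi> w - \<phi>' (y - w)) \<le> e / 2 * norm (y - w)"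
    using assms \<open>e > 0\<close> unfolding has_derivative_at_alt by (meson half_gt_zero)
  have "dist ((\<phi> (w + of_real r * cis t) - \<phi> w) / of_real r) (\<phi>' (cis t)) < e" if "0 < r" "r < d" for r t
  proof -
    have "\<phi>' (of_real r * cis t) = of_real r * \<phi>' (cis t)"
      using scaleR[of r "cis t"] by (simp add: scaleR_conv_of_real)
    then have "(\<phi> (w + of_real r * cis t) - \<phi> w) / of_real r - \<phi>' (cis t)
        = (\<phi> (w + of_real r * cis t) - \<phi> w - \<phi>' (of_real r * cis t)) / of_real r"
      using that by (simp add: field_simps)
    moreover have "norm (\<phi> (w + of_real r * cis t) - \<phi> w - \<phi>' (of_real r * cis t)) \<le> e / 2 * r"
      using d(2)[of "w + of_real r * cis t"] that by (simp add: norm_mult)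
    ultimately show ?thesis
      using that \<open>e > 0\<close> by (simp add: dist_norm norm_divide divide_simps) (smt (verit) mult_pos_pos)
  qed
  then show "\<forall>\<^sub>F r in at_right 0. \<forall>t\<in>A. dist ((\<phi> (w + of_real r * cis t) - \<phi> w) / of_real r) (\<phi>' (cis t)) < e"
    using \<open>d > 0\<close> unfolding eventually_at_right_field by blast
qed

lemma uniform_limit_circle:
  fixes \<phi> :: "complex \<Rightarrow> complex"
  assumes "continuous (at w) \<phi>"
  shows "uniform_limit A (\<lambda>r t. \<phi> (w + of_real r * cis t)) (\<lambda>t. \<phi> w) (at_right 0)"
proof (rule uniform_limitI)
  fix e :: real assume "e > 0"
  then obtain d where d: "d > 0" "\<And>y. dist y w < d \<Longrightarrow> dist (\<phi> y) (\<phi> w) < e"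
    using assms unfolding continuous_at_eps_delta by blast
  have "dist (\<phi> (w + of_real r * cis t)) (\<phi> w) < e" if "0 < r" "r < d" for r t
    using d(2)[of "w + of_real r * cis t"] that by (simp add: dist_norm norm_mult)
  then show "\<forall>\<^sub>F r in at_right 0. \<forall>t\<in>A. dist (\<phi> (w + of_real r * cis t)) (\<phi> w) < e"
    using \<open>d > 0\<close> unfolding eventually_at_right_field by blast
qed

section \<open>The d-bar operator in terms of the real derivative\<close>

lemma dbar_eq:
  assumes "(f has_derivative f') (at z)"
  shows "dbar f z = 1/2 * (f' 1 + \<i> * f' \<i>)"
proof -
  interpret bounded_linear f' using assms by (rule has_derivative_bounded_linear)
  have "((\<lambda>x. Complex x (Im z)) has_derivative (\<lambda>h. complex_of_real h)) (at (Re z))"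
    unfolding Complex_eq by (auto intro!: derivative_eq_intros)
  then have "((\<lambda>x. f (Complex x (Im z))) has_derivative (\<lambda>h. f' (complex_of_real h))) (at (Re z))"
    by (rule has_derivative_compose) (use assms in simp)
  moreover have "f' (complex_of_real h) = h *\<^sub>R f' 1" for h
    using scaleR[of h 1] by (simp add: scaleR_conv_of_real)
  ultimately have x: "partial_x f z = f' 1"
    unfolding partial_x_def by (intro vector_derivative_at) (simp add: has_vector_derivative_def)
  have "((\<lambda>y. Complex (Re z) y) has_derivative (\<lambda>h. \<i> * complex_of_real h)) (at (Im z))"
    unfolding Complex_eq by (auto intro!: derivative_eq_intros)
  then have "((\<lambda>y. f (Complex (Re z) y)) has_derivative (\<lambda>h. f' (\<i> * complex_of_real h))) (at (Im z))"
    by (rule has_derivative_compose) (use assms in simp)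
  moreover have "f' (\<i> * complex_of_real h) = h *\<^sub>R f' \<i>" for h
    using scaleR[of h \<i>] by (simp add: scaleR_conv_of_real mult.commute)
  ultimately have y: "partial_y f z = f' \<i>"
    unfolding partial_y_def by (intro vector_derivative_at) (simp add: has_vector_derivative_def)
  show ?thesis unfolding dbar_def x y ..
qed

section \<open>Second-order growth of the circle means of |f|^2\<close>

text \<open>Here \<open>p\<close> and \<open>g\<close> are the Wirtinger derivatives f_z and f_zbar,
  and \<alpha> is the z-derivative of conj(f) g at w. For smooth f, \<alpha> = |g|^2 + conj(f) g_z,
  so the bound on \<open>l\<close> is a quarter of the Laplacian of |f|^2 at w, the coefficient of
  r^2 in the circle mean. The form with \<alpha> needs no second derivatives of f.\<close>

lemma circle_mean_growth:
  fixes f p g :: "complex \<Rightarrow> complex"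
  assumes R: "R > 0"
    and der: "\<And>z. z \<in> ball w R \<Longrightarrow> (f has_derivative (\<lambda>h. p z * h + g z * cnj h)) (at z)"
    and contp: "continuous_on (ball w R) p" and contg: "continuous_on (ball w R) g"
    and derH: "((\<lambda>z. cnj (f z) * g z) has_derivative (\<lambda>h. \<alpha> * h + \<beta> * cnj h)) (at w)"
    and l: "l < 2 * Re \<alpha> + (cmod (p w))\<^sup>2 - (cmod (g w))\<^sup>2"
  shows "\<forall>\<^sub>F r in at_right 0. 2 * pi * ((cmod (f w))\<^sup>2 + l * r\<^sup>2)
           < integral {0..2 * pi} (\<lambda>t. (cmod (f (w + of_real r * cis t)))\<^sup>2)"
proof -
  define \<gamma> where "\<gamma> = (\<lambda>r t. w + complex_of_real r * cis t)"
  define m where "m = (\<lambda>r. integral {0..2*pi} (\<lambda>t. (cmod (f (\<gamma> r t)))\<^sup>2))"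
  define D where "D = (\<lambda>r. integral {0..2*pi} (\<lambda>t. 2 * Re (cnj (f (\<gamma> r t)) *
        (p (\<gamma> r t) * cis t + g (\<gamma> r t) * cnj (cis t)))))"
  have \<gamma>_in: "\<gamma> r t \<in> ball w R" if "0 \<le> r" "r < R" for r t
    using that by (simp add: \<gamma>_def dist_norm norm_mult)
  have contf: "continuous_on (ball w R) f"
    using der has_derivative_continuous continuous_at_imp_continuous_on by blast
  have cont\<gamma>: "continuous_on A (\<lambda>x. \<gamma> (fst x) (snd x))" for A
    unfolding \<gamma>_def by (intro continuous_intros)
  have cont\<gamma>2: "continuous_on A (\<gamma> r)" for A r
    unfolding \<gamma>_def by (intro continuous_intros)
  have comp2: "continuous_on A (\<lambda>t. h (\<gamma> r t))" if "continuous_on (ball w R) h" "0 \<le> r" "r < R"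
    for A r and h :: "complex \<Rightarrow> complex"
    using continuous_on_compose2[OF that(1) cont\<gamma>2[of A r]] \<gamma>_in that by blast
  have comp: "continuous_on ({0..<R} \<times> A) (\<lambda>x. h (\<gamma> (fst x) (snd x)))" if "continuous_on (ball w R) h"
    for A and h :: "complex \<Rightarrow> complex"
    by (rule continuous_on_compose2[OF that cont\<gamma>]) (use \<gamma>_in in auto)
  \<comment> \<open>Continuity includes the endpoint 0, because the derivative of \<open>m\<close>
    is computed only for positive radii.\<close>
  have m_cont: "continuous_on {0..r} m" if "r < R" for r
  proof -
    have "continuous_on {0..r} (\<lambda>r. integral (cbox 0 (2*pi)) (\<lambda>t. (cmod (f (\<gamma> r t)))\<^sup>2))"
      by (rule integral_continuous_on_param, unfold case_prod_unfold,
          intro continuous_intros continuous_on_subset[OF comp[OF contf]]) (use that in auto)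
    then show ?thesis by (simp add: m_def[abs_def])
  qed
  have m_deriv: "(m has_real_derivative D r) (at r)" if "0 < r" "r < R" for r
  proof -
    have "((\<lambda>r. integral (cbox 0 (2*pi)) (\<lambda>t. (cmod (f (\<gamma> r t)))\<^sup>2)) has_field_derivative
       integral (cbox 0 (2*pi)) (\<lambda>t. 2 * Re (cnj (f (\<gamma> r t)) *
        (p (\<gamma> r t) * cis t + g (\<gamma> r t) * cnj (cis t))))) (at r within {0<..<R})"
    proof (rule leibniz_rule_field_derivative)
      fix r t :: real assume r: "r \<in> {0<..<R}"
      have "((\<lambda>r. \<gamma> r t) has_derivative (\<lambda>h. of_real h * cis t)) (at r within {0<..<R})"
        unfolding \<gamma>_def by (auto intro!: derivative_eq_intros)
      from has_derivative_compose[OF this der] r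
      have *: "((\<lambda>r. f (\<gamma> r t)) has_derivative
         (\<lambda>h. p (\<gamma> r t) * (of_real h * cis t) + g (\<gamma> r t) * cnj (of_real h * cis t))) (at r within {0<..<R})"
        using \<gamma>_in by simp
      show "((\<lambda>r. (cmod (f (\<gamma> r t)))\<^sup>2) has_field_derivative 2 * Re (cnj (f (\<gamma> r t)) *
        (p (\<gamma> r t) * cis t + g (\<gamma> r t) * cnj (cis t)))) (at r within {0<..<R})"
        unfolding has_field_derivative_def power2_norm_eq_inner
        by (rule has_derivative_eq_rhs[OF has_derivative_inner[OF * *]])
          (auto simp: inner_complex_def algebra_simps)
    next
      fix r assume "r \<in> {0<..<R}"
      then show "(\<lambda>t. (cmod (f (\<gamma> r t)))\<^sup>2) integrable_on cbox 0 (2 * pi)"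
        by (intro integrable_continuous continuous_intros comp2[OF contf]) auto
    next
      show "continuous_on ({0<..<R} \<times> cbox 0 (2 * pi)) (\<lambda>(r, t). 2 * Re (cnj (f (\<gamma> r t)) *
        (p (\<gamma> r t) * cis t + g (\<gamma> r t) * cnj (cis t))))"
        unfolding case_prod_unfold
        by (intro continuous_intros continuous_on_subset[OF comp] contf contp contg) auto
    qed (use that in auto)
    then show ?thesis
      using that by (simp add: m_def[abs_def] D_def at_within_open[of r "{0<..<R}"])
  qed
  \<comment> \<open>With e = \<open>cis t\<close> and Q = p e - g conj(e), the angular derivative is
    i r Q and the radial one is p e + g conj(e) = Q + 2 g conj(e). \<open>P\<close> is conj(f) times
    the radial derivative, less the mean-zero terms conj(f(w)) Q and 2 conj(f(w)) g(w) conj(e),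
    divided by r.\<close>
  define P where "P = (\<lambda>r t. 2 * ((cnj (f (\<gamma> r t)) * g (\<gamma> r t) - cnj (f w) * g w) / of_real r) * cnj (cis t)
     + cnj ((f (\<gamma> r t) - f w) / of_real r) * (p (\<gamma> r t) * cis t - g (\<gamma> r t) * cnj (cis t)))"
  have P_cont: "continuous_on A (P r)" if "0 < r" "r < R" for r A
    unfolding P_def using that
    by (intro continuous_intros comp2 contf contp contg) auto
  \<comment> \<open>The angular derivative has mean zero over the circle, so \<open>f\<close> and \<open>cnj f * g\<close> may be
    replaced by their increments; this supplies the factor \<open>r\<close>.\<close>
  have D_eq: "D r = r * integral {0..2*pi} (\<lambda>t. 2 * Re (P r t))" if r: "0 < r" "r < R" for r
  proof -
    define Q where "Q = (\<lambda>t. p (\<gamma> r t) * cis t - g (\<gamma> r t) * cnj (cis t))"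
    have "((\<lambda>t. \<i> * r * Q t) has_integral f (\<gamma> r (2*pi)) - f (\<gamma> r 0)) {0..2*pi}"
    proof (rule fundamental_theorem_of_calculus)
      fix t :: real
      have "(\<gamma> r has_derivative (\<lambda>h. of_real h * (of_real r * (\<i> * cis t)))) (at t within {0..2*pi})"
        unfolding \<gamma>_def
        by (rule has_derivative_eq_rhs, (rule derivative_intros)+) (simp add: fun_eq_iff scaleR_conv_of_real)
      from has_derivative_compose[OF this der] r
      have *: "((\<lambda>t. f (\<gamma> r t)) has_derivative
         (\<lambda>h. p (\<gamma> r t) * (of_real h * (of_real r * (\<i> * cis t))) +
            g (\<gamma> r t) * cnj (of_real h * (of_real r * (\<i> * cis t))))) (at t within {0..2*pi})"
        using \<gamma>_in by simp
      show "((\<lambda>t. f (\<gamma> r t)) has_vector_derivative \<i> * r * Q t) (at t within {0..2*pi})"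
        unfolding has_vector_derivative_def Q_def
        by (rule has_derivative_eq_rhs[OF *]) (auto simp: scaleR_conv_of_real algebra_simps)
    qed simp
    then have "((\<lambda>t. \<i> * r * Q t) has_integral 0) {0..2*pi}"
      by (simp add: \<gamma>_def)
    from has_integral_mult_right[OF this, of "1 / (\<i> * r)"] r
    have "(Q has_integral 0) {0..2*pi}" by simp
    from has_integral_mult_right[OF this, of "cnj (f w)"]
    have Q0: "((\<lambda>t. cnj (f w) * Q t) has_integral 0) {0..2*pi}" by simp
    have C0: "((\<lambda>t. 2 * cnj (f w) * g w * cnj (cis t)) has_integral 0) {0..2*pi}"
      using has_integral_trig_poly[of 0 0 "2 * cnj (f w) * g w" 0 0] by simp
    have "P r integrable_on {0..2*pi}"
      using P_cont[OF r] by (rule integrable_continuous_interval)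
    then have PI: "(P r has_integral integral {0..2*pi} (P r)) {0..2*pi}"
      by (rule integrable_integral)
    have "((\<lambda>t. 2 * Re (r * P r t + (cnj (f w) * Q t + 2 * cnj (f w) * g w * cnj (cis t)))) has_integral
        2 * Re (r * integral {0..2*pi} (P r) + (0 + 0))) {0..2*pi}"
      by (intro has_integral_mult_right has_integral_Re has_integral_add PI Q0 C0)
    moreover have "r * P r t + (cnj (f w) * Q t + 2 * cnj (f w) * g w * cnj (cis t))
       = cnj (f (\<gamma> r t)) * (p (\<gamma> r t) * cis t + g (\<gamma> r t) * cnj (cis t))" for t
      using r unfolding P_def Q_def by (simp add: field_simps)
    ultimately have "D r = r * (2 * Re (integral {0..2*pi} (P r)))"
      unfolding D_def by (simp add: integral_unique)
    also have "2 * Re (integral {0..2*pi} (P r)) = integral {0..2*pi} (\<lambda>t. 2 * Re (P r t))"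
      by (rule sym, rule integral_unique, intro has_integral_mult_right has_integral_Re PI)
    finally show ?thesis .
  qed
  \<comment> \<open>The limit of \<open>P\<close> as r tends to 0: difference quotients become
    derivatives at w in direction \<open>cis t\<close>, while \<open>p\<close> and \<open>g\<close>
    take their values at w.\<close>
  define K where "K = (\<lambda>t. 2 * (\<alpha> * cis t + \<beta> * cnj (cis t)) * cnj (cis t)
     + cnj (p w * cis t + g w * cnj (cis t)) * (p w * cis t - g w * cnj (cis t)))"
  have cisn: "cis t * cnj (cis t) = 1" for t
    by (simp add: cis_cnj cis_mult)
  have K_eq: "K t = (2 * \<alpha> + p w * cnj (p w) - g w * cnj (g w)) + 0 * cis t + 0 * cnj (cis t)
       + (p w * cnj (g w)) * (cis t)\<^sup>2 + (2 * \<beta> - g w * cnj (p w)) * (cnj (cis t))\<^sup>2" for t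
  proof -
    have K_eq: "K t = (2 * \<alpha> + p w * cnj (p w) - g w * cnj (g w)) * (cis t * cnj (cis t))
       + (p w * cnj (g w)) * (cis t)\<^sup>2 + (2 * \<beta> - g w * cnj (p w)) * (cnj (cis t))\<^sup>2"
      unfolding K_def by (simp add: algebra_simps power2_eq_square)
    then show ?thesis unfolding cisn by simp
  qed
  have K_int: "(K has_integral of_real (2*pi) * (2 * \<alpha> + p w * cnj (p w) - g w * cnj (g w))) {0..2*pi}"
    unfolding ext[OF K_eq] by (rule has_integral_trig_poly)
  have K_cont: "continuous_on A K" for A
    unfolding K_def by (intro continuous_intros)
  \<comment> \<open>Products of uniform limits converge uniformly when the limits are bounded; here
    each limit is a continuous function of \<open>cis t\<close> on a compact interval.\<close>
  have bdd: "bounded ((\<lambda>t. q (cis t)) ` {0..2*pi})" if "continuous_on UNIV q" for q :: "complex \<Rightarrow> complex"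
    by (intro compact_imp_bounded compact_continuous_image continuous_on_compose2[OF that]) (auto intro: continuous_intros)
  have pw: "continuous (at w) p" and gw: "continuous (at w) g"
    using contp contg R by (auto simp: continuous_on_eq_continuous_at)
  have lim_P: "uniform_limit {0..2*pi} P K (at_right 0)"
  proof -
    have H: "uniform_limit {0..2*pi} (\<lambda>r t. (cnj (f (\<gamma> r t)) * g (\<gamma> r t) - cnj (f w) * g w) / of_real r)
       (\<lambda>t. \<alpha> * cis t + \<beta> * cnj (cis t)) (at_right 0)"
      unfolding \<gamma>_def using uniform_limit_circle_quotient[OF derH] .
    have F: "uniform_limit {0..2*pi} (\<lambda>r t. (f (\<gamma> r t) - f w) / of_real r)
       (\<lambda>t. p w * cis t + g w * cnj (cis t)) (at_right 0)"
      unfolding \<gamma>_def using R by (intro uniform_limit_circle_quotient[OF der]) auto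
    have F': "uniform_limit {0..2*pi} (\<lambda>r t. cnj ((f (\<gamma> r t) - f w) / of_real r))
       (\<lambda>t. cnj (p w * cis t + g w * cnj (cis t))) (at_right 0)"
      by (rule bounded_linear.uniform_limit[OF bounded_linear_cnj F])
    have pw': "uniform_limit {0..2*pi} (\<lambda>r t. p (\<gamma> r t)) (\<lambda>t. p w) (at_right 0)"
      unfolding \<gamma>_def by (rule uniform_limit_circle[OF pw])
    have gw': "uniform_limit {0..2*pi} (\<lambda>r t. g (\<gamma> r t)) (\<lambda>t. g w) (at_right 0)"
      unfolding \<gamma>_def by (rule uniform_limit_circle[OF gw])
    have mult: "uniform_limit {0..2*pi} (\<lambda>r t. A r t * B r t) (\<lambda>t. a (cis t) * b (cis t)) (at_right 0)"
      if "uniform_limit {0..2*pi} A (\<lambda>t. a (cis t)) (at_right 0)"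
         "uniform_limit {0..2*pi} B (\<lambda>t. b (cis t)) (at_right 0)"
         "continuous_on UNIV a" "continuous_on UNIV b"
      for A B :: "real \<Rightarrow> real \<Rightarrow> complex" and a b :: "complex \<Rightarrow> complex"
      using that by (intro uniform_lim_mult bdd)
    have Q': "uniform_limit {0..2*pi} (\<lambda>r t. p (\<gamma> r t) * cis t - g (\<gamma> r t) * cnj (cis t))
       (\<lambda>t. p w * cis t - g w * cnj (cis t)) (at_right 0)"
      by (intro uniform_limit_minus mult[of _ "\<lambda>z. p w" _ "\<lambda>z. z"] mult[of _ "\<lambda>z. g w" _ cnj]
          pw' gw' uniform_limit_const continuous_intros)
    have "uniform_limit {0..2*pi} (\<lambda>r t. 2 * ((cnj (f (\<gamma> r t)) * g (\<gamma> r t) - cnj (f w) * g w) / of_real r))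
       (\<lambda>t. 2 * (\<alpha> * cis t + \<beta> * cnj (cis t))) (at_right 0)"
      by (rule bounded_linear.uniform_limit[OF bounded_linear_mult_right H])
    then have H': "uniform_limit {0..2*pi} (\<lambda>r t. 2 * ((cnj (f (\<gamma> r t)) * g (\<gamma> r t) - cnj (f w) * g w) / of_real r) * cnj (cis t))
       (\<lambda>t. 2 * (\<alpha> * cis t + \<beta> * cnj (cis t)) * cnj (cis t)) (at_right 0)"
      by (rule mult[of _ "\<lambda>z. 2 * (\<alpha> * z + \<beta> * cnj z)" _ cnj])
        (intro uniform_limit_const continuous_intros)+
    show ?thesis
      unfolding P_def K_def
      by (intro uniform_limit_add H' Q' F'
        mult[of _ "\<lambda>z. cnj (p w * z + g w * cnj z)" _ "\<lambda>z. p w * z - g w * cnj z"] continuous_intros)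
  qed
  define J where "J = integral {0..2*pi} (\<lambda>t. 2 * Re (K t))"
  have J: "((\<lambda>t. 2 * Re (K t)) has_integral J) {0..2*pi}"
    unfolding J_def by (intro integrable_integral integrable_continuous_interval continuous_intros K_cont)
  have "J = 2 * Re (of_real (2*pi) * (2 * \<alpha> + p w * cnj (p w) - g w * cnj (g w)))"
    using has_integral_unique[OF J has_integral_mult_right[OF has_integral_Re[OF K_int]]] .
  also have "\<dots> = 4 * pi * (2 * Re \<alpha> + (cmod (p w))\<^sup>2 - (cmod (g w))\<^sup>2)"
    unfolding complex_norm_square[symmetric] by simp
  finally have "J > 4 * pi * l"
    using l by simp
  \<comment> \<open>With this \<open>e\<close> the total error 2 pi e is half of the gap between
    \<open>J\<close> and 4 pi l, so the perturbed integral still exceeds 4 pi l.\<close>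
  define e where "e = (J - 4 * pi * l) / (4 * pi)"
  have "e > 0" using \<open>J > 4 * pi * l\<close> by (simp add: e_def)
  have "uniform_limit {0..2*pi} (\<lambda>r t. 2 * Re (P r t)) (\<lambda>t. 2 * Re (K t)) (at_right 0)"
    by (rule bounded_linear.uniform_limit[OF bounded_linear_const_mult[OF bounded_linear_Re] lim_P])
  from uniform_limitD[OF this \<open>e > 0\<close>] obtain d where d: "d > 0"
    "\<And>r t. 0 < r \<Longrightarrow> r < d \<Longrightarrow> t \<in> {0..2*pi} \<Longrightarrow> dist (2 * Re (P r t)) (2 * Re (K t)) < e"
    unfolding eventually_at_right_field by blast
  have D_gt: "D r > 4 * pi * l * r" if r: "0 < r" "r < R" "r < d" for r
  proof -
    have "J - 2 * pi * e \<le> integral {0..2*pi} (\<lambda>t. 2 * Re (P r t))"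
    proof (rule has_integral_le)
      show "((\<lambda>t. 2 * Re (K t) - e) has_integral J - 2 * pi * e) {0..2*pi}"
        using has_integral_diff[OF J has_integral_const_real[of e 0 "2*pi"]] by simp
      show "((\<lambda>t. 2 * Re (P r t)) has_integral integral {0..2*pi} (\<lambda>t. 2 * Re (P r t))) {0..2*pi}"
        using r by (intro integrable_integral integrable_continuous_interval continuous_intros P_cont)
      show "2 * Re (K t) - e \<le> 2 * Re (P r t)" if "t \<in> {0..2*pi}" for t
        using d(2)[OF r(1,3) that] by (simp add: dist_real_def)
    qed
    moreover have "J - 2 * pi * e = (J + 4 * pi * l) / 2"
      by (simp add: e_def field_simps)
    then have "J - 2 * pi * e > 4 * pi * l"
      using \<open>J > 4 * pi * l\<close> by simp
    ultimately have "r * (4 * pi * l) < r * integral {0..2*pi} (\<lambda>t. 2 * Re (P r t))"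
      using r(1) by (intro mult_strict_left_mono) linarith+
    then show ?thesis
      unfolding D_eq[OF r(1,2)] by (simp only: mult.commute)
  qed
  \<comment> \<open>Integrates the inequality m'(s) > 4 pi l s from 0 to r, in the form that m(s) -
    2 pi l s^2 is increasing.\<close>
  have "m 0 + 2 * pi * l * r\<^sup>2 < m r" if r: "0 < r" "r < min R d" for r
  proof -
    have "m 0 - 2 * pi * l * 0\<^sup>2 < m r - 2 * pi * l * r\<^sup>2"
    proof (rule DERIV_pos_imp_increasing_open[OF r(1)])
      show "continuous_on {0..r} (\<lambda>r. m r - 2 * pi * l * r\<^sup>2)"
        using r by (intro continuous_intros m_cont) auto
      show "\<exists>y. ((\<lambda>r. m r - 2 * pi * l * r\<^sup>2) has_real_derivative y) (at s) \<and> 0 < y" if "0 < s" "s < r" for s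
        using that r D_gt[of s]
        by (intro exI[of _ "D s - 4 * pi * l * s"]) (auto intro!: derivative_eq_intros m_deriv)
    qed
    then show ?thesis by simp
  qed
  moreover have "m 0 = 2 * pi * (cmod (f w))\<^sup>2"
    by (simp add: m_def \<gamma>_def)
  ultimately show ?thesis
    unfolding eventually_at_right_field using R d(1)
    by (intro exI[of _ "min R d"]) (auto simp: m_def \<gamma>_def algebra_simps)
qed

section \<open>The z-derivative supplied by the equation\<close>

text \<open>Formally conj(f) |f|^(1/2) = conj(f)^(5/4) f^(1/4). Since the z-derivative of conj(f) is
  conj(f_zbar) = |f|^(1/2), the first factor contributes (5/4)|f| to the coefficient of h, and the
  second the term with \<open>p\<close>. The coefficient \<beta> reaches the growth lemma only
  through a frequency-two term of mean zero, hence no formula for it.\<close>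

lemma has_derivative_cnj_mult_sqrt_norm:
  fixes f :: "complex \<Rightarrow> complex"
  assumes f: "(f has_derivative (\<lambda>h. p * h + of_real (sqrt (cmod (f w))) * cnj h)) (at w)"
    and nz: "f w \<noteq> 0"
  defines "n \<equiv> cmod (f w)" and "s \<equiv> complex_of_real (sqrt (cmod (f w)))"
  obtains \<beta> where
    "((\<lambda>z. cnj (f z) * of_real (sqrt (cmod (f z)))) has_derivative
       (\<lambda>h. (of_real (5 / 4 * n) + (cnj (f w))\<^sup>2 * p / (4 * s * of_real n)) * h + \<beta> * cnj h)) (at w)"
proof -
  define F where "F = f w"
  have n: "n > 0" "complex_of_real n \<noteq> 0" "s \<noteq> 0" using nz by (auto simp: n_def s_def)
  have ss: "s * s = of_real n" unfolding s_def n_def by (simp flip: of_real_mult)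
  have FF: "F * cnj F = of_real n * of_real n"
    unfolding F_def n_def by (metis complex_norm_square of_real_mult power2_eq_square)
  have f': "(f has_derivative (\<lambda>h. p * h + s * cnj h)) (at w)" using f by (simp add: s_def)
  define u where "u = (\<lambda>h. p * h + s * cnj h)"
  have "((\<lambda>z. cnj (f z) * of_real (sqrt (cmod (f z)))) has_derivative
      (\<lambda>h. cnj F * of_real ((u h \<bullet> sgn F) * (1 / (2 * sqrt n))) + cnj (u h) * s)) (at w)"
    unfolding u_def F_def n_def
    by (rule has_derivative_eq_rhs)
       (rule derivative_intros f' has_derivative_norm[THEN has_derivative_compose[OF f']] nz bounded_linear.has_derivative[OF bounded_linear_cnj]
         bounded_linear.has_derivative[OF bounded_linear_of_real] | use nz in \<open>simp add: s_def fun_eq_iff divide_simps\<close>)+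
  moreover have "cnj F * of_real ((u h \<bullet> sgn F) * (1 / (2 * sqrt n))) + cnj (u h) * s =
     (of_real (5 / 4 * n) + (cnj F)\<^sup>2 * p / (4 * s * of_real n)) * h
       + (cnj F * (cnj F * s + F * cnj p) / (4 * s * of_real n) + cnj p * s) * cnj h" for h
  proof -
    have s_cnj: "cnj s = s" by (simp add: s_def)
    have "u h \<bullet> sgn F = Re (u h * cnj F) / n"
      by (simp add: inner_complex_def sgn_div_norm F_def n_def field_simps add_divide_distrib)
    then have "complex_of_real ((u h \<bullet> sgn F) * (1 / (2 * sqrt n))) = of_real (2 * Re (u h * cnj F)) / (4 * s * of_real n)"
      using n by (simp add: s_def frac_eq_eq algebra_simps flip: n_def)
    also have "complex_of_real (2 * Re (u h * cnj F)) = u h * cnj F + cnj (u h) * F"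
      by (metis complex_add_cnj complex_cnj_cnj complex_cnj_mult)
    finally have *: "complex_of_real ((u h \<bullet> sgn F) * (1 / (2 * sqrt n))) = (u h * cnj F + cnj (u h) * F) / (4 * s * of_real n)" .
    \<comment> \<open>Naming the reciprocal turns the claim into a polynomial identity modulo the
      relations \<open>FF\<close>, \<open>ss\<close> and \<open>X\<close>.\<close>
    define X where "X = 1 / (4 * s * complex_of_real n)"
    have X: "4 * s * complex_of_real n * X = 1" using n by (simp add: X_def)
    have "cnj F * (u h * cnj F + cnj (u h) * F) * X + cnj (u h) * s =
      (5 / 4 * of_real n + (cnj F)\<^sup>2 * p * X) * h + (cnj F * (cnj F * s + F * cnj p) * X + cnj p * s) * cnj h"
    proof -
      \<comment> \<open>This quarter of \<open>n\<close> comes from differentiating the modulus;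
        together with s * s = n from conj(f) it gives 5/4.\<close>
      have "cnj F * F * s * X = of_real n / 4"
        using FF X by algebra
      moreover have "cnj F * (u h * cnj F + cnj (u h) * F) * X + cnj (u h) * s =
        ((cnj F * F * s * X) + s * s + (cnj F)\<^sup>2 * p * X) * h + (cnj F * (cnj F * s + F * cnj p) * X + cnj p * s) * cnj h"
        unfolding u_def by (simp add: s_cnj power2_eq_square algebra_simps)
      ultimately show ?thesis unfolding ss by simp
    qed
    then show ?thesis
      unfolding * by (simp add: X_def)
  qed
  ultimately show ?thesis
    using that unfolding F_def by simp
qed

section \<open>The maximum argument\<close>

theorem theorem2:
  fixes f :: "complex \<Rightarrow> complex"
  assumes "continuous_on (ball 0 1) f"
    and "continuously_differentiable_on f {z \<in> ball 0 1. f z \<noteq> 0}"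
    and "\<And>z. z \<in> ball 0 1 \<Longrightarrow> f z \<noteq> 0 \<Longrightarrow> dbar f z = complex_of_real (sqrt (cmod (f z)))"
    and "f 0 \<noteq> 0"
  shows "(SUP z \<in> ball 0 1. ereal (cmod (f z))) \<ge> ereal (1 / 10)"
proof (rule ccontr)
  assume "\<not> ?thesis"
  then obtain M where M: "(SUP z \<in> ball 0 1. ereal (cmod (f z))) < ereal M" "ereal M < ereal (1/10)"
    using ereal_dense2 by (metis not_le)
  have fM: "cmod (f z) < M" if "z \<in> ball 0 1" for z
    using M(1) SUP_upper[OF that, of "\<lambda>z. ereal (cmod (f z))"] by (meson ereal_less_eq(3) le_less_trans less_ereal.simps(1))
  have "M > 0" using fM[of 0] by (simp, smt (verit) norm_ge_zero)
  \<comment> \<open>Chosen so that \<rho>^4 / 100 = M^2, which makes v negative on the boundary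
    circle; \<rho> < 1 is exactly M < 1/10.\<close>
  define \<rho> where "\<rho> = sqrt (10 * M)"
  have \<rho>: "0 < \<rho>" "\<rho> < 1" "\<rho> ^ 4 = 100 * M\<^sup>2"
    using \<open>M > 0\<close> M(2) by (auto simp: \<rho>_def real_sqrt_lt_1_iff power2_eq_square power4_eq_xxxx)
  define v where "v = (\<lambda>z. (cmod (f z))\<^sup>2 - cmod z ^ 4 / 100)"
  have sub: "cball 0 \<rho> \<subseteq> ball (0::complex) 1" using \<rho> by auto
  have "continuous_on (cball 0 \<rho>) v"
    unfolding v_def by (intro continuous_intros continuous_on_subset[OF assms(1) sub]) auto
  then obtain w where w: "w \<in> cball 0 \<rho>" "\<And>z. z \<in> cball 0 \<rho> \<Longrightarrow> v z \<le> v w"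
    using continuous_attains_sup[of "cball 0 \<rho>" v] \<rho>(1) by (auto simp del: mem_cball)
  have "v 0 > 0"
    using assms(4) by (simp add: v_def)
  with w(2)[of 0] have "v w > 0"
    using \<rho>(1) by simp
  have "cmod w \<noteq> \<rho>"
  proof
    assume "cmod w = \<rho>"
    moreover have "(cmod (f w))\<^sup>2 < M\<^sup>2"
      using fM[of w] w(1) sub by (intro power_strict_mono) auto
    ultimately show False using \<open>v w > 0\<close> \<rho>(3) by (simp add: v_def)
  qed
  with w(1) have w_in: "w \<in> ball 0 \<rho>" by auto
  have fw: "f w \<noteq> 0" using \<open>v w > 0\<close> by (auto simp: v_def)
  define n where "n = cmod (f w)"
  have "n > 0" using fw by (simp add: n_def)
  \<comment> \<open>Positivity of v at w bounds |w|^2 by 10 n, and so the r^2 coefficient 4 |w|^2 /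
    100 of the comparison mean by 2n/5.\<close>
  have "((cmod w)\<^sup>2 / 10)\<^sup>2 < n\<^sup>2"
    using \<open>v w > 0\<close> by (simp add: v_def n_def power_divide)
  then have w_n: "(cmod w)\<^sup>2 < 10 * n"
    using \<open>n > 0\<close> power_less_imp_less_base by fastforce
  have "open (ball 0 \<rho> \<inter> f -` (- {0}))"
    using \<rho>(2) by (intro continuous_open_preimage continuous_on_subset[OF assms(1)]) auto
  then obtain R where R: "R > 0" "ball w R \<subseteq> ball 0 \<rho> \<inter> f -` (- {0})"
    using w_in fw by (metis Int_iff ComplI open_contains_ball singletonD vimageI2)
  have R_sub: "ball w R \<subseteq> {z \<in> ball 0 1. f z \<noteq> 0}"
    using R(2) \<rho>(2) by fastforce
  obtain f' where f': "\<And>z. z \<in> {z \<in> ball 0 1. f z \<noteq> 0} \<Longrightarrow> (f has_derivative blinfun_apply (f' z)) (at z)"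
    and f'_cont: "continuous_on {z \<in> ball 0 1. f z \<noteq> 0} f'"
    using assms(2) unfolding continuously_differentiable_on_def by blast
  define g where "g = (\<lambda>z. complex_of_real (sqrt (cmod (f z))))"
  \<comment> \<open>\<open>p\<close> is f_z, while the equation identifies \<open>g\<close> with
    f_zbar; together they express the real derivative as p h + g conj(h).\<close>
  define p where "p = (\<lambda>z. (blinfun_apply (f' z) 1 - \<i> * blinfun_apply (f' z) \<i>) / 2)"
  have der: "(f has_derivative (\<lambda>h. p z * h + g z * cnj h)) (at z)" if "z \<in> ball w R" for z
  proof (rule has_derivative_eq_rhs[OF f'])
    show z: "z \<in> {z \<in> ball 0 1. f z \<noteq> 0}" using that R_sub by blast
    have g: "g z = 1/2 * (blinfun_apply (f' z) 1 + \<i> * blinfun_apply (f' z) \<i>)"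
      using assms(3)[of z] dbar_eq[OF f'[OF z]] z by (simp add: g_def)
    show "blinfun_apply (f' z) = (\<lambda>h. p z * h + g z * cnj h)"
    proof
      fix h
      have "blinfun_apply (f' z) h = blinfun_apply (f' z) (Re h *\<^sub>R 1 + Im h *\<^sub>R \<i>)"
        by (rule arg_cong[of _ _ "blinfun_apply (f' z)"]) (simp add: complex_eq_iff)
      also have "\<dots> = of_real (Re h) * blinfun_apply (f' z) 1 + of_real (Im h) * blinfun_apply (f' z) \<i>"
        unfolding blinfun.add_right blinfun.scaleR_right by (simp only: scaleR_conv_of_real)
      also have "\<dots> = p z * (of_real (Re h) + \<i> * of_real (Im h)) + g z * (of_real (Re h) - \<i> * of_real (Im h))"
        unfolding p_def g by (simp add: field_simps)
      also have "\<dots> = p z * h + g z * cnj h"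
        by (simp add: complex_eq_iff)
      finally show "blinfun_apply (f' z) h = p z * h + g z * cnj h" .
    qed
  qed
  have f_cont: "continuous_on (ball w R) f"
    using R_sub by (intro continuous_on_subset[OF assms(1)]) auto
  have "continuous_on (ball w R) p" "continuous_on (ball w R) g"
    unfolding p_def g_def
    by (intro continuous_intros continuous_on_subset[OF f'_cont R_sub] f_cont; simp)+
  moreover obtain \<beta> where "((\<lambda>z. cnj (f z) * g z) has_derivative
       (\<lambda>h. (of_real (5 / 4 * n) + (cnj (f w))\<^sup>2 * p w / (4 * g w * of_real n)) * h + \<beta> * cnj h)) (at w)"
    using has_derivative_cnj_mult_sqrt_norm[OF der[of w, unfolded g_def] fw] R(1) unfolding g_def n_def by auto
  \<comment> \<open>The right side is at least (23/16) n; the weaker rate n already beats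
    2n/5.\<close>
  moreover have "n < 2 * Re (of_real (5 / 4 * n) + (cnj (f w))\<^sup>2 * p w / (4 * g w * of_real n))
      + (cmod (p w))\<^sup>2 - (cmod (g w))\<^sup>2"
  proof -
    define s where "s = sqrt n"
    have s: "s > 0" "n = s\<^sup>2" using \<open>n > 0\<close> by (auto simp: s_def)
    define x where "x = s * cmod (p w)"
    define q where "q = (cnj (f w))\<^sup>2 * p w / (4 * g w * of_real n)"
    have "cmod q = x / 4"
      using s \<open>n > 0\<close> by (simp add: q_def x_def norm_mult norm_divide norm_power g_def flip: n_def s_def)
        (simp add: field_simps power2_eq_square power4_eq_xxxx)
    then have "Re q \<ge> - (x / 4)"
      using abs_Re_le_cmod[of q] by linarith
    moreover have "(cmod (g w))\<^sup>2 = n"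
      using \<open>n > 0\<close> by (simp add: g_def flip: n_def)
    \<comment> \<open>Completes the square in |p(w)|: the expression required is |p|^2 - s |p| / 2 +
      s^2 / 2, and 1/2 - 1/16 = 7/16.\<close>
    moreover have "0 < (cmod (p w) - s / 4)\<^sup>2 + 7 / 16 * s\<^sup>2"
      using s by (intro add_nonneg_pos) auto
    then have "0 < (cmod (p w))\<^sup>2 - x / 2 + s\<^sup>2 / 2"
      by (simp add: x_def power2_eq_square algebra_simps)
    ultimately show ?thesis
      unfolding q_def[symmetric] plus_complex.simps Re_complex_of_real using s(2)
      by (simp add: algebra_simps)
  qed
  ultimately have "\<forall>\<^sub>F r in at_right 0. 2 * pi * (n\<^sup>2 + n * r\<^sup>2)
           < integral {0..2 * pi} (\<lambda>t. (cmod (f (w + of_real r * cis t)))\<^sup>2)"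
    unfolding n_def using circle_mean_growth[OF R(1) der] by blast
  then obtain d where d: "d > 0" "\<And>r. 0 < r \<Longrightarrow> r < d \<Longrightarrow> 2 * pi * (n\<^sup>2 + n * r\<^sup>2)
           < integral {0..2 * pi} (\<lambda>t. (cmod (f (w + of_real r * cis t)))\<^sup>2)"
    unfolding eventually_at_right_field by blast
  \<comment> \<open>\<open>R\<close> keeps the circle where w is maximal, \<open>d\<close> gives the
    growth bound, and r < sqrt n lets n absorb the quartic remainder. Halving makes all three bounds
    strict.\<close>
  define r where "r = min (min d R) (sqrt n) / 2"
  have r: "0 < r" "r < d" "r < R" "r < sqrt n"
    using d(1) R(1) \<open>n > 0\<close> by (auto simp: r_def min_def)
  have circle: "w + of_real r * cis t \<in> ball w R" for t
    using r by (simp add: dist_norm norm_mult)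
  \<comment> \<open>Averages the maximality inequality v \<le> v(w) over the circle, giving an upper
    bound to set against the growth estimate.\<close>
  have "integral {0..2 * pi} (\<lambda>t. (cmod (f (w + of_real r * cis t)))\<^sup>2) \<le>
      2 * pi * v w + 2 * pi * (cmod w ^ 4 + 4 * (cmod w)\<^sup>2 * r\<^sup>2 + r ^ 4) / 100"
  proof (rule has_integral_le)
    have "continuous_on {0..2*pi} (\<lambda>t. f (w + of_real r * cis t))"
      by (rule continuous_on_compose2[OF f_cont]) (use circle in \<open>auto intro!: continuous_intros\<close>)
    then show "((\<lambda>t. (cmod (f (w + of_real r * cis t)))\<^sup>2) has_integral
       integral {0..2 * pi} (\<lambda>t. (cmod (f (w + of_real r * cis t)))\<^sup>2)) {0..2*pi}"
      by (intro integrable_integral integrable_continuous_interval continuous_intros)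
    show "((\<lambda>t. v w + cmod (w + of_real r * cis t) ^ 4 / 100) has_integral
       2 * pi * v w + 2 * pi * (cmod w ^ 4 + 4 * (cmod w)\<^sup>2 * r\<^sup>2 + r ^ 4) / 100) {0..2*pi}"
      using has_integral_add[OF has_integral_const_real[of "v w" 0 "2*pi"] has_integral_divide[OF circle_mean_norm_power4[of w r], of 100]]
      by simp
    show "(cmod (f (w + of_real r * cis t)))\<^sup>2 \<le> v w + cmod (w + of_real r * cis t) ^ 4 / 100" for t
      using w(2)[of "w + of_real r * cis t"] circle[of t] R(2) by (auto simp: v_def)
  qed
  \<comment> \<open>Since v(w) = n^2 - |w|^4 / 100, the quartic terms in |w| cancel and only
    positive powers of r remain to compare.\<close>
  with d(2)[OF r(1,2)] have "2 * pi * (n\<^sup>2 + n * r\<^sup>2) <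
     2 * pi * (n\<^sup>2 + (4 * (cmod w)\<^sup>2 * r\<^sup>2 + r ^ 4) / 100)"
    by (simp add: v_def n_def algebra_simps add_divide_distrib)
  then have "n * r\<^sup>2 < (4 * (cmod w)\<^sup>2 * r\<^sup>2 + r ^ 4) / 100"
    by simp
  also have "\<dots> = ((4 * (cmod w)\<^sup>2 + r\<^sup>2) / 100) * r\<^sup>2"
    by (simp add: power2_eq_square power4_eq_xxxx algebra_simps)
  finally have "100 * n < 4 * (cmod w)\<^sup>2 + r\<^sup>2"
    using r(1) by simp
  moreover have "r\<^sup>2 < n"
    using r \<open>n > 0\<close> by (metis less_eq_real_def power_strict_mono real_sqrt_pow2 zero_less_numeral)
  \<comment> \<open>The bounds give 100 n < 4 * 10 n + n = 41 n.\<close>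
  ultimately show False using w_n \<open>n > 0\<close> by linarith
qed

end
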